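(* Let $A_n = A_n(h,T)$ be an apex tree. Then the negative frustration index $l(-A_n)$ equals the maximum cardinality of a collection of pairwise edge-disjoint and pairwise endpoint-disjoint odd paths in $T$.
   Context: All graphs are finite, simple and undirected. A signed graph $\Sigma=(G,\sigma)$ is a graph $G$ with a signature $\sigma:E(G)\to\{+1,-1\}$. The sign of a cycle is the product of the signs of its edges; $\Sigma$ is balanced if all its cycles are positive. The frustration index $l(\Sigma)$ is the minimum number of edges whose deletion makes $\Sigma$ balanced. $-G$ is the graph $G$ with all edges signed $-1$; $l(-G)$ is the negative frustration index of $G$. An odd path is a path with an odd number of edges. Two paths are endpoint-disjoint if no vertex is an endpoint of both (an endpoint of one may be an internal vertex of the other). Apex tree: $A_n(h,T)$ denotes a graph with a vertex $h$ of degree $n$ such that deleting $h$ and the edges incident to it leaves the tree $T$. Standing assumptions: all leaves of $T$ are neighbours of $h$; the graph is $2$-connected (the trivial case $A_1=K_2$ is allowed); and every vertex of degree $2$ in the graph is contained in a triangle.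
   Formalization: The odd paths in T are additionally required to have both endpoints among the neighbours of h; without this the claim fails (an apex tree on 10 vertices has l(-A_n) at most 3 but four such odd paths). *)

theory Defs
  imports Main
begin

record 'a ugraph =
  verts :: "'a set"
  edges :: "'a set set"

definition simple_graph :: "'a ugraph \<Rightarrow> bool" where
  "simple_graph G \<longleftrightarrow>
     finite (verts G) \<and> (\<forall>e\<in>edges G. e \<subseteq> verts G \<and> card e = 2)"

definition neighbours :: "'a ugraph \<Rightarrow> 'a \<Rightarrow> 'a set" where
  "neighbours G v = {w. {v, w} \<in> edges G}"

definition degree :: "'a ugraph \<Rightarrow> 'a \<Rightarrow> nat" where
  "degree G v = card {e \<in> edges G. v \<in> e}"

definition delete_vertex :: "'a ugraph \<Rightarrow> 'a \<Rightarrow> 'a ugraph" where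
  "delete_vertex G v = \<lparr>verts = verts G - {v}, edges = {e \<in> edges G. v \<notin> e}\<rparr>"

definition delete_edges :: "'a ugraph \<Rightarrow> 'a set set \<Rightarrow> 'a ugraph" where
  "delete_edges G F = \<lparr>verts = verts G, edges = edges G - F\<rparr>"

fun walk_edges :: "'a list \<Rightarrow> 'a set list" where
  "walk_edges (x # y # zs) = {x, y} # walk_edges (y # zs)"
| "walk_edges _ = []"

definition is_path :: "'a ugraph \<Rightarrow> 'a list \<Rightarrow> bool" where
  "is_path G p \<longleftrightarrow>
     p \<noteq> [] \<and> distinct p \<and> set p \<subseteq> verts G \<and> set (walk_edges p) \<subseteq> edges G"

definition path_endpoints :: "'a list \<Rightarrow> 'a set" where
  "path_endpoints p = {hd p, last p}"

text \<open>A cycle is given by its vertices in cyclic order, without repeating the first one.\<close>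

definition cycle_edges :: "'a list \<Rightarrow> 'a set list" where
  "cycle_edges c = walk_edges (c @ [hd c])"

definition is_cycle :: "'a ugraph \<Rightarrow> 'a list \<Rightarrow> bool" where
  "is_cycle G c \<longleftrightarrow>
     3 \<le> length c \<and> distinct c \<and> set c \<subseteq> verts G \<and> set (cycle_edges c) \<subseteq> edges G"

definition connected_graph :: "'a ugraph \<Rightarrow> bool" where
  "connected_graph G \<longleftrightarrow> verts G \<noteq> {} \<and>
     (\<forall>u\<in>verts G. \<forall>v\<in>verts G. \<exists>p. is_path G p \<and> hd p = u \<and> last p = v)"

definition is_tree :: "'a ugraph \<Rightarrow> bool" where
  "is_tree T \<longleftrightarrow> simple_graph T \<and> connected_graph T \<and> (\<nexists>c. is_cycle T c)"

definition two_connected :: "'a ugraph \<Rightarrow> bool" where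
  "two_connected G \<longleftrightarrow> 3 \<le> card (verts G) \<and> connected_graph G \<and>
     (\<forall>v\<in>verts G. connected_graph (delete_vertex G v))"

definition in_triangle :: "'a ugraph \<Rightarrow> 'a \<Rightarrow> bool" where
  "in_triangle G v \<longleftrightarrow> (\<exists>c. is_cycle G c \<and> length c = 3 \<and> v \<in> set c)"

definition signed_graph :: "'a ugraph \<Rightarrow> ('a set \<Rightarrow> int) \<Rightarrow> bool" where
  "signed_graph G \<sigma> \<longleftrightarrow> simple_graph G \<and> (\<forall>e\<in>edges G. \<sigma> e \<in> {1, - 1})"

definition cycle_sign :: "('a set \<Rightarrow> int) \<Rightarrow> 'a list \<Rightarrow> int" where
  "cycle_sign \<sigma> c = prod_list (map \<sigma> (cycle_edges c))"

definition balanced :: "'a ugraph \<Rightarrow> ('a set \<Rightarrow> int) \<Rightarrow> bool" where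
  "balanced G \<sigma> \<longleftrightarrow> (\<forall>c. is_cycle G c \<longrightarrow> cycle_sign \<sigma> c = 1)"

definition frustration_index :: "'a ugraph \<Rightarrow> ('a set \<Rightarrow> int) \<Rightarrow> nat" where
  "frustration_index G \<sigma> =
     Min {card F | F. F \<subseteq> edges G \<and> balanced (delete_edges G F) \<sigma>}"

definition all_negative :: "'a set \<Rightarrow> int" where
  "all_negative e = - 1"

lemma signed_graph_all_negative: "simple_graph G \<Longrightarrow> signed_graph G all_negative"
  by (simp add: signed_graph_def all_negative_def)

text \<open>
  The disjunct \<open>n = 1 \<and> card (verts G) = 2\<close> is the trivial case of \<open>K\<^sub>2\<close>:
  together with \<open>degree G h = n\<close> it forces \<open>G\<close> to be a single edge.
\<close>

definition apex_tree :: "nat \<Rightarrow> 'a ugraph \<Rightarrow> 'a \<Rightarrow> 'a ugraph \<Rightarrow> bool" where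
  "apex_tree n G h T \<longleftrightarrow>
     simple_graph G \<and> h \<in> verts G \<and> degree G h = n \<and>
     delete_vertex G h = T \<and> is_tree T \<and>
     (\<forall>v\<in>verts T. degree T v = 1 \<longrightarrow> v \<in> neighbours G h) \<and>
     (two_connected G \<or> n = 1 \<and> card (verts G) = 2) \<and>
     (\<forall>v\<in>verts G. degree G v = 2 \<longrightarrow> in_triangle G v)"

text \<open>
  The parameter \<open>S\<close> is the set of vertices allowed as endpoints. A path and its reversal are
  different lists, but an odd path has an edge, so edge-disjointness excludes having both in \<open>P\<close>.

  For an apex tree, \<open>S\<close> has to be the set of neighbours of the apex \<open>h\<close>: such an odd path closes
  up through \<open>h\<close> to an odd cycle. With \<open>S = verts T\<close> the packing number can exceed the negative
  frustration index. Take \<open>T\<close> with edges \<open>cp, py, yx, yx', ca, ab, ca', a'b'\<close>, and join \<open>h\<close> to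
  every vertex of \<open>T\<close> except \<open>c\<close>. Deleting \<open>hy, hb, hb'\<close> leaves a bipartite graph, while
  \<open>pc, yx, ab, a'b'\<close> are four odd paths with no common edges or endpoints.
\<close>

definition odd_path_packing :: "'a ugraph \<Rightarrow> 'a set \<Rightarrow> 'a list set \<Rightarrow> bool" where
  "odd_path_packing T S P \<longleftrightarrow>
     (\<forall>p\<in>P. is_path T p \<and> odd (length (walk_edges p)) \<and> path_endpoints p \<subseteq> S) \<and>
     (\<forall>p\<in>P. \<forall>q\<in>P. p \<noteq> q \<longrightarrow>
        set (walk_edges p) \<inter> set (walk_edges q) = {} \<and>
        path_endpoints p \<inter> path_endpoints q = {})"

end

(* Let S be the set of neighbours of h and c a proper 2-colouring of T.  An odd path of T with
   both ends in S closes up through h to a negative cycle, and disjoint paths give edge-disjoint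
   cycles, so every packing is at most as large as every balancing edge set.  Conversely, the odd
   paths with ends in S are exactly the paths of T joining the two colour classes of S, so
   equality is an instance of the edge version of Menger's theorem.  In a forest this has a direct
   proof: place the elements of S as tokens of two types on their vertices and remove vertices of
   degree at most one.  If tokens of both types sit on the vertex v to be removed, link two of
   them.  Otherwise at most one token can leave v through its only edge, so move one token to the
   neighbour and discard the others. *)

theory Submission
  imports Defs
begin

section \<open>Walks\<close>

lemma walk_edges_Cons: "p \<noteq> [] \<Longrightarrow> walk_edges (v # p) = {v, hd p} # walk_edges p"
  by (cases p) auto

lemma walk_edges_snoc: "p \<noteq> [] \<Longrightarrow> walk_edges (p @ [v]) = walk_edges p @ [{last p, v}]"
  by (induction p rule: walk_edges.induct) auto

lemma length_walk_edges: "length (walk_edges p) = length p - 1"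
  by (induction p rule: walk_edges.induct) auto

lemma set_walk_edges_take: "set (walk_edges (take k p)) \<subseteq> set (walk_edges p)"
proof (induction p arbitrary: k rule: walk_edges.induct)
  case (1 x y zs)
  show ?case
  proof (cases k)
    case (Suc j)
    then show ?thesis using 1[of j] by (cases j) auto
  qed simp
qed (auto simp: take_Cons')

lemma walk_edges_subset: "e \<in> set (walk_edges p) \<Longrightarrow> e \<subseteq> set p"
  by (induction p rule: walk_edges.induct) auto

text \<open>Every edge switches \<open>f\<close>, so the ends agree exactly when the number of
  switches is even. Vertices may repeat, which lets this serve both paths and closed walks
  \<open>c @ [hd c]\<close>.\<close>

lemma walk_alternates:
  assumes "p \<noteq> []" and "\<And>x y. {x, y} \<in> set (walk_edges p) \<Longrightarrow> f x \<noteq> (f y :: bool)"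
  shows "f (hd p) = f (last p) \<longleftrightarrow> even (length (walk_edges p))"
  using assms
proof (induction p rule: walk_edges.induct)
  case (1 x y zs)
  have "f x \<noteq> f y" using "1.prems"(2)[of x y] by simp
  moreover have "f y = f (last (y # zs)) \<longleftrightarrow> even (length (walk_edges (y # zs)))"
    using "1.IH" "1.prems"(2) by simp
  ultimately show ?case by auto
qed auto

section \<open>Forests\<close>

lemma edge_endpoints:
  assumes "simple_graph G" "{x, y} \<in> edges G"
  shows "x \<in> verts G" "y \<in> verts G" "x \<noteq> y"
  using assms by (force simp: simple_graph_def)+

lemma edge_pairE:
  assumes "simple_graph G" "e \<in> edges G"
  obtains x y where "e = {x, y}" "x \<noteq> y"
  using assms by (auto simp: simple_graph_def card_2_iff)

lemma finite_edges: "simple_graph G \<Longrightarrow> finite (edges G)"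
  unfolding simple_graph_def by (rule finite_subset[of _ "Pow (verts G)"]) auto

lemma simple_graph_delete_vertex: "simple_graph G \<Longrightarrow> simple_graph (delete_vertex G v)"
  by (auto simp: simple_graph_def delete_vertex_def)

lemma is_cycle_delete_vertex: "is_cycle (delete_vertex G v) c \<Longrightarrow> is_cycle G c"
  by (auto simp: is_cycle_def delete_vertex_def)

lemma is_path_delete_vertex: "is_path (delete_vertex G v) p \<Longrightarrow> is_path G p \<and> v \<notin> set p"
  by (auto simp: is_path_def delete_vertex_def)

text \<open>The first vertex of a longest path has all its neighbours on the path, and any of them
  beyond the second vertex would close a cycle.\<close>

lemma forest_has_leaf:
  assumes T: "simple_graph T" and acyc: "\<nexists>c. is_cycle T c" and "verts T \<noteq> {}"
  obtains v u where "v \<in> verts T" "neighbours T v \<subseteq> {u}"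
proof -
  have fin: "finite (verts T)" using T by (simp add: simple_graph_def)
  obtain a where "a \<in> verts T" using assms(3) by blast
  then have "is_path T [a]" by (simp add: is_path_def)
  moreover have "\<forall>p. is_path T p \<longrightarrow> length p < Suc (card (verts T))"
    by (metis fin card_mono distinct_card is_path_def less_Suc_eq_le)
  ultimately obtain p where p: "is_path T p" and
    max: "\<And>q. is_path T q \<Longrightarrow> length q \<le> length p"
    using ex_has_greatest_nat[of "is_path T" "[a]" length] by blast
  from p have ne: "p \<noteq> []" and dist: "distinct p" and sub: "set p \<subseteq> verts T"
    and we: "set (walk_edges p) \<subseteq> edges T" by (auto simp: is_path_def)
  \<comment> \<open>If \<open>p\<close> has only one vertex, \<open>p ! 1\<close> is an arbitrary
    value. This is harmless: a neighbour would need a nonzero position on \<open>p\<close>, so there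
    is none.\<close>
  have "neighbours T (hd p) \<subseteq> {p ! 1}"
  proof
    fix w assume "w \<in> neighbours T (hd p)"
    then have e: "{hd p, w} \<in> edges T" by (simp add: neighbours_def)
    note w = edge_endpoints[OF T e]
    have "w \<in> set p"
    proof (rule ccontr)
      assume "w \<notin> set p"
      then have "is_path T (w # p)"
        using p w e ne by (auto simp: is_path_def walk_edges_Cons insert_commute)
      then show False using max[of "w # p"] by simp
    qed
    then obtain k where k: "k < length p" "w = p ! k" by (auto simp: in_set_conv_nth)
    have "k \<noteq> 0" using k w(3) ne hd_conv_nth by metis
    moreover have "\<not> 2 \<le> k"
    proof
      assume "2 \<le> k"
      let ?c = "take (Suc k) p"
      have "?c \<noteq> []" "hd ?c = hd p" using ne by simp_all
      moreover have "last ?c = w" using k by (simp add: take_Suc_conv_app_nth)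
      ultimately have "cycle_edges ?c = walk_edges ?c @ [{w, hd p}]"
        by (simp add: cycle_edges_def walk_edges_snoc)
      then have "is_cycle T ?c"
        using \<open>2 \<le> k\<close> k dist sub we e set_walk_edges_take[of "Suc k" p] set_take_subset[of "Suc k" p]
        by (auto simp: is_cycle_def insert_commute)
      then show False using acyc by blast
    qed
    ultimately have "k = 1" by linarith
    then show "w \<in> {p ! 1}" using k by simp
  qed
  then show thesis using that sub ne by (meson hd_in_set subsetD)
qed

text \<open>A forest can be dismantled by removing vertices of degree at most one. Acyclicity passes
  to vertex deletions and supplies the next such vertex, so the three cases speak of simple graphs
  only.\<close>

lemma forest_induct [consumes 2, case_names empty isolated pendant]:
  assumes "simple_graph T" "\<nexists>c. is_cycle T c"
    and empty: "\<And>T. simple_graph T \<Longrightarrow> verts T = {} \<Longrightarrow> P T"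
    and isolated: "\<And>T v. simple_graph T \<Longrightarrow> v \<in> verts T \<Longrightarrow> neighbours T v = {} \<Longrightarrow>
      P (delete_vertex T v) \<Longrightarrow> P T"
    and pendant: "\<And>T v u. simple_graph T \<Longrightarrow> v \<in> verts T \<Longrightarrow> neighbours T v = {u} \<Longrightarrow>
      P (delete_vertex T v) \<Longrightarrow> P T"
  shows "P T"
  using assms(1,2)
proof (induction "card (verts T)" arbitrary: T rule: less_induct)
  case less
  show ?case
  proof (cases "verts T = {}")
    case True
    then show ?thesis using empty less.prems by blast
  next
    case False
    then obtain v u where v: "v \<in> verts T" "neighbours T v \<subseteq> {u}"
      using forest_has_leaf less.prems by metis
    have "finite (verts T)" using less.prems by (simp add: simple_graph_def)
    moreover have "verts (delete_vertex T v) \<subset> verts T"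
      using v by (auto simp: delete_vertex_def)
    ultimately have "card (verts (delete_vertex T v)) < card (verts T)"
      by (rule psubset_card_mono)
    then have "P (delete_vertex T v)"
      using less is_cycle_delete_vertex simple_graph_delete_vertex by metis
    then show ?thesis
      using v isolated pendant less.prems(1) by (metis subset_singletonD)
  qed
qed

lemma edges_delete_vertex_isolated:
  assumes "simple_graph T" "neighbours T v = {}"
  shows "edges T = edges (delete_vertex T v)"
proof -
  have "v \<notin> e" if e: "e \<in> edges T" for e
  proof
    assume "v \<in> e"
    with e assms(1) obtain w where "e = {v, w}"
      by (metis edge_pairE insertE insert_commute singletonD)
    then show False using e assms(2) by (auto simp: neighbours_def)
  qed
  then show ?thesis by (auto simp: delete_vertex_def)
qed

lemma edges_delete_vertex_pendant:
  assumes "simple_graph T" "neighbours T v = {u}"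
  shows "edges T = insert {v, u} (edges (delete_vertex T v))"
proof -
  have "e = {v, u}" if e: "e \<in> edges T" "v \<in> e" for e
  proof -
    from e assms(1) obtain w where "e = {v, w}"
      by (metis edge_pairE insertE insert_commute singletonD)
    then show ?thesis using e assms(2) by (auto simp: neighbours_def)
  qed
  moreover have "{v, u} \<in> edges T" using assms(2) by (auto simp: neighbours_def)
  ultimately show ?thesis unfolding delete_vertex_def ugraph.simps by blast
qed

text \<open>A pendant vertex has a single neighbour, so a colouring of the rest extends by giving it
  the opposite colour.\<close>

lemma forest_two_colouring:
  assumes "simple_graph T" "\<nexists>c. is_cycle T c"
  shows "\<exists>c :: 'a \<Rightarrow> bool. \<forall>x y. {x, y} \<in> edges T \<longrightarrow> c x \<noteq> c y"
  using assms
proof (induction T rule: forest_induct)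
  case (empty T)
  then show ?case using edge_endpoints by fastforce
next
  case (isolated T v)
  then show ?case by (simp add: edges_delete_vertex_isolated)
next
  case (pendant T v u)
  then obtain c :: "'a \<Rightarrow> bool"
    where c: "\<forall>x y. {x, y} \<in> edges (delete_vertex T v) \<longrightarrow> c x \<noteq> c y" by blast
  have "u \<noteq> v" using pendant edge_endpoints(3)[of T v u] by (auto simp: neighbours_def)
  then have "(c(v := \<not> c u)) x \<noteq> (c(v := \<not> c u)) y" if "{x, y} \<in> edges T" for x y
  proof (cases "{x, y} = {v, u}")
    case True
    then show ?thesis using \<open>u \<noteq> v\<close> by (auto simp: doubleton_eq_iff)
  next
    case False
    then have "{x, y} \<in> edges (delete_vertex T v)"
      using that edges_delete_vertex_pendant[OF pendant.hyps(1,3)] by simp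
    then have "c x \<noteq> c y" "x \<noteq> v" "y \<noteq> v" using c by (auto simp: delete_vertex_def)
    then show ?thesis by simp
  qed
  then show ?case by blast
qed

section \<open>Linking tokens of two types in a forest\<close>

text \<open>Tokens are indices with positions because moving them can put several on one vertex. A
  path runs from a \<open>True\<close> token to a \<open>False\<close> token and may be a single
  vertex if both sit there.\<close>

definition link ::
  "'a ugraph \<Rightarrow> 'i set \<Rightarrow> ('i \<Rightarrow> 'a) \<Rightarrow> ('i \<Rightarrow> bool) \<Rightarrow> 'i \<times> 'i \<times> 'a list \<Rightarrow> bool" where
  "link T I pos ty = (\<lambda>(i, j, p). i \<in> I \<and> j \<in> I \<and> ty i \<and> \<not> ty j \<and>
     is_path T p \<and> hd p = pos i \<and> last p = pos j)"

text \<open>In links a first and a second token differ by type, so comparing \<open>i\<close> with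
  \<open>i'\<close> and \<open>j\<close> with \<open>j'\<close> makes all four tokens distinct. The
  paths may share vertices.\<close>

definition compatible :: "'i \<times> 'i \<times> 'a list \<Rightarrow> 'i \<times> 'i \<times> 'a list \<Rightarrow> bool" where
  "compatible = (\<lambda>(i, j, p) (i', j', p').
     i \<noteq> i' \<and> j \<noteq> j' \<and> set (walk_edges p) \<inter> set (walk_edges p') = {})"

definition linkage ::
  "'a ugraph \<Rightarrow> 'i set \<Rightarrow> ('i \<Rightarrow> 'a) \<Rightarrow> ('i \<Rightarrow> bool) \<Rightarrow> ('i \<times> 'i \<times> 'a list) set \<Rightarrow> bool" where
  "linkage T I pos ty L \<longleftrightarrow>
     finite L \<and> (\<forall>m\<in>L. link T I pos ty m) \<and> pairwise compatible L"

text \<open>The capacity of a cut in the network where each token is a unit edge from its position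
  to a terminal, the source for type \<open>True\<close> and the sink for type \<open>False\<close>;
  \<open>g\<close> is \<open>True\<close> on the source side.\<close>

definition cut_cost ::
  "'a ugraph \<Rightarrow> 'i set \<Rightarrow> ('i \<Rightarrow> 'a) \<Rightarrow> ('i \<Rightarrow> bool) \<Rightarrow> ('a \<Rightarrow> bool) \<Rightarrow> nat" where
  "cut_cost T I pos ty g =
     card {i \<in> I. g (pos i) \<noteq> ty i} + card {e \<in> edges T. \<exists>x\<in>e. \<exists>y\<in>e. g x \<noteq> g y}"

section \<open>Building linkages and comparing cut costs\<close>

lemma compatible_sym: "compatible m m' \<Longrightarrow> compatible m' m"
  by (cases m; cases m') (auto simp: compatible_def)

lemma not_compatible_refl: "\<not> compatible m m"
  by (cases m) (auto simp: compatible_def)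

lemma linkage_insert:
  assumes "linkage T I pos ty L" "link T I pos ty m" "\<And>m'. m' \<in> L \<Longrightarrow> compatible m m'"
  shows "linkage T I pos ty (insert m L)" "card (insert m L) = Suc (card L)"
proof -
  have "compatible m' m" if "m' \<in> L" for m' using assms(3)[OF that] by (rule compatible_sym)
  then show "linkage T I pos ty (insert m L)"
    using assms by (simp add: linkage_def pairwise_insert)
  have "m \<notin> L" using assms(3) not_compatible_refl by blast
  then show "card (insert m L) = Suc (card L)" using assms(1) by (simp add: linkage_def)
qed

lemma linkage_subset: "linkage T I pos ty L \<Longrightarrow> L' \<subseteq> L \<Longrightarrow> linkage T I pos ty L'"
  unfolding linkage_def by (meson finite_subset pairwise_subset subsetD)

lemma linkage_mono:
  assumes "linkage T' J pos' ty L"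
    and "\<And>m. m \<in> L \<Longrightarrow> link T' J pos' ty m \<Longrightarrow> link T I pos ty m"
  shows "linkage T I pos ty L"
  using assms unfolding linkage_def by blast

lemma linkage_insert_trivial:
  assumes L: "linkage T (I - {i, j}) pos ty L" and "i \<in> I" "j \<in> I" "ty i" "\<not> ty j"
    and "pos i = v" "pos j = v" "v \<in> verts T"
  shows "linkage T I pos ty (insert (i, j, [v]) L)" "card (insert (i, j, [v]) L) = Suc (card L)"
proof -
  have 1: "linkage T I pos ty L" using L by (rule linkage_mono) (auto simp: link_def)
  have 2: "link T I pos ty (i, j, [v])" using assms by (auto simp: link_def is_path_def)
  have 3: "compatible (i, j, [v]) m" if "m \<in> L" for m
    using that L by (cases m) (auto simp: linkage_def link_def compatible_def)
  show "linkage T I pos ty (insert (i, j, [v]) L)" "card (insert (i, j, [v]) L) = Suc (card L)"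
    using linkage_insert[OF 1 2 3] by auto
qed

text \<open>Whatever \<open>g\<close> assigns to the common position, it disagrees with exactly one
  of the two types, so the pair adds one to the cost of every cut.\<close>

lemma cut_cost_remove_pair:
  assumes "finite I" "i \<in> I" "j \<in> I" "ty i" "\<not> ty j" "pos i = pos j"
  shows "cut_cost T I pos ty g = Suc (cut_cost T (I - {i, j}) pos ty g)"
proof -
  let ?W = "\<lambda>J. {i \<in> J. g (pos i) \<noteq> ty i}"
  obtain k where k: "k \<in> {i, j}" "?W I = insert k (?W (I - {i, j}))"
  proof (cases "g (pos i)")
    case True
    have "?W I = insert j (?W (I - {i, j}))" using assms True by fastforce
    then show ?thesis using that[of j] by simp
  next
    case False
    have "?W I = insert i (?W (I - {i, j}))" using assms False by fastforce
    then show ?thesis using that[of i] by simp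
  qed
  have "k \<notin> ?W (I - {i, j})" using k by blast
  then have "card (?W I) = Suc (card (?W (I - {i, j})))"
    using assms(1) k(2) by simp
  then show ?thesis by (simp add: cut_cost_def)
qed

text \<open>Serves to lengthen a single path by a new edge \<open>e\<close>: the other paths avoid
  \<open>e\<close>, so edge-disjointness survives.\<close>

lemma linkage_replace_path:
  assumes L: "linkage T I pos ty (insert (i, j, p) L)" "(i, j, p) \<notin> L"
    and q: "link T' I' pos' ty (i, j, q)"
    and rest: "linkage T' I' pos' ty L"
    and new: "set (walk_edges q) \<subseteq> insert e (set (walk_edges p))"
      "\<And>i j p. (i, j, p) \<in> L \<Longrightarrow> e \<notin> set (walk_edges p)"
  shows "linkage T' I' pos' ty (insert (i, j, q) L)"
    "card (insert (i, j, q) L) = card (insert (i, j, p) L)"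
proof -
  have c: "compatible (i, j, q) m" if "m \<in> L" for m
  proof -
    obtain i' j' p' where m: "m = (i', j', p')" by (cases m) auto
    have "compatible (i, j, p) m"
      using L that unfolding linkage_def pairwise_insert by metis
    then show ?thesis using new that unfolding m by (auto simp: compatible_def)
  qed
  show "linkage T' I' pos' ty (insert (i, j, q) L)" using linkage_insert[OF rest q c] by blast
  show "card (insert (i, j, q) L) = card (insert (i, j, p) L)"
    using linkage_insert(2)[OF rest q c] L rest by (simp add: linkage_def)
qed

text \<open>A linkage and a cut of equal value form the min-max certificate carried through the
  induction. The bound of packings by balancing sets is proved separately, in
  \<open>card_packing_le_card_balancing\<close>.\<close>

definition tight :: "'a ugraph \<Rightarrow> 'i set \<Rightarrow> ('i \<Rightarrow> 'a) \<Rightarrow> ('i \<Rightarrow> bool) \<Rightarrow> bool" where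
  "tight T I pos ty \<longleftrightarrow> (\<exists>g L. linkage T I pos ty L \<and> cut_cost T I pos ty g = card L)"

text \<open>Linking two opposite tokens on \<open>v\<close> by the trivial path raises the linkage
  and the cost of any cut by one each. Cancelling such pairs until none remains leaves tokens of a
  single type on \<open>v\<close>, the case \<open>pure\<close>.\<close>

lemma tight_cancel_tokens:
  assumes pure: "\<And>J. J \<subseteq> I \<Longrightarrow> (\<And>i j. i \<in> J \<Longrightarrow> j \<in> J \<Longrightarrow> pos i = v \<Longrightarrow> pos j = v \<Longrightarrow> ty i = ty j) \<Longrightarrow>
      tight T J pos ty"
    and "v \<in> verts T" "finite I"
  shows "tight T I pos ty"
  using assms(3,1)
proof (induction I rule: finite_psubset_induct)
  case (psubset I)
  show ?case
  proof (cases "\<exists>i\<in>I. \<exists>j\<in>I. pos i = v \<and> pos j = v \<and> ty i \<and> \<not> ty j")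
    case False
    then show ?thesis using psubset.prems[of I] by blast
  next
    case True
    then obtain i j where ij: "i \<in> I" "j \<in> I" "pos i = v" "pos j = v" "ty i" "\<not> ty j" by blast
    have "tight T (I - {i, j}) pos ty"
    proof (rule psubset.IH)
      fix J assume "J \<subseteq> I - {i, j}"
        "\<And>i j. i \<in> J \<Longrightarrow> j \<in> J \<Longrightarrow> pos i = v \<Longrightarrow> pos j = v \<Longrightarrow> ty i = ty j"
      then show "tight T J pos ty" by (intro psubset.prems) blast+
    qed (use ij in auto)
    then obtain g L where "linkage T (I - {i, j}) pos ty L"
      "cut_cost T (I - {i, j}) pos ty g = card L"
      by (auto simp: tight_def)
    then have "linkage T I pos ty (insert (i, j, [v]) L)"
      "cut_cost T I pos ty g = card (insert (i, j, [v]) L)"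
      using linkage_insert_trivial[of T I i j pos ty L v] cut_cost_remove_pair[of I i j ty pos T g]
        ij psubset.hyps assms(2) by auto
    then show ?thesis unfolding tight_def by blast
  qed
qed

section \<open>Transferring tightness across a deleted vertex\<close>

lemma cut_edges_update_deleted:
  "{e \<in> edges (delete_vertex T v). \<exists>x\<in>e. \<exists>y\<in>e. (g(v := b)) x \<noteq> (g(v := b)) y} =
   {e \<in> edges (delete_vertex T v). \<exists>x\<in>e. \<exists>y\<in>e. g x \<noteq> g y}"
  by (auto simp: delete_vertex_def)

lemma linkage_undelete:
  assumes "linkage (delete_vertex T v) {i \<in> I. pos i \<noteq> v} pos ty L"
  shows "linkage T I pos ty L"
  using assms by (rule linkage_mono) (auto simp: link_def is_path_delete_vertex)

text \<open>With \<open>g v\<close> set to the common type \<open>b\<close>, no token on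
  \<open>v\<close> is charged, and no edge meets \<open>v\<close>; hence linkage and cut of the rest
  keep their values.\<close>

lemma tight_isolated:
  assumes T: "simple_graph T" "neighbours T v = {}"
    and b: "\<And>i. i \<in> I \<Longrightarrow> pos i = v \<Longrightarrow> ty i = b"
    and "tight (delete_vertex T v) {i \<in> I. pos i \<noteq> v} pos ty"
  shows "tight T I pos ty"
proof -
  obtain g L where L: "linkage (delete_vertex T v) {i \<in> I. pos i \<noteq> v} pos ty L"
    and c: "cut_cost (delete_vertex T v) {i \<in> I. pos i \<noteq> v} pos ty g = card L"
    using assms(4) by (auto simp: tight_def)
  have "{i \<in> I. (g(v := b)) (pos i) \<noteq> ty i} = {i \<in> {i \<in> I. pos i \<noteq> v}. g (pos i) \<noteq> ty i}"
    using b by auto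
  then have "cut_cost T I pos ty (g(v := b)) = card L"
    using c unfolding cut_cost_def edges_delete_vertex_isolated[OF T] cut_edges_update_deleted
    by simp
  with linkage_undelete[OF L] show ?thesis unfolding tight_def by blast
qed

lemma cut_edges_pendant:
  assumes T: "simple_graph T" "neighbours T v = {u}"
  shows "card {e \<in> edges T. \<exists>x\<in>e. \<exists>y\<in>e. (g(v := b)) x \<noteq> (g(v := b)) y} =
    card {e \<in> edges (delete_vertex T v). \<exists>x\<in>e. \<exists>y\<in>e. g x \<noteq> g y} + (if g u = b then 0 else 1)"
proof -
  let ?D = "{e \<in> edges (delete_vertex T v). \<exists>x\<in>e. \<exists>y\<in>e. g x \<noteq> g y}"
  have "u \<noteq> v" using T edge_endpoints(3)[of T v u] by (auto simp: neighbours_def)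
  have "{e \<in> edges T. \<exists>x\<in>e. \<exists>y\<in>e. (g(v := b)) x \<noteq> (g(v := b)) y} =
      ?D \<union> (if g u = b then {} else {{v, u}})"
    unfolding cut_edges_update_deleted[of T v g b, symmetric] edges_delete_vertex_pendant[OF T]
    using \<open>u \<noteq> v\<close> by auto
  moreover have "{v, u} \<notin> ?D" by (simp add: delete_vertex_def)
  moreover have "finite ?D" using finite_edges[OF simple_graph_delete_vertex[OF T(1)]] by simp
  ultimately show ?thesis by simp
qed

text \<open>Putting \<open>v\<close> on the side of \<open>u\<close> leaves the pendant edge uncut,
  so the cut extends at no cost.\<close>

lemma tight_pendant_unused:
  assumes T: "simple_graph T" "neighbours T v = {u}"
    and b: "\<And>i. i \<in> I \<Longrightarrow> pos i \<noteq> v"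
    and "tight (delete_vertex T v) I pos ty"
  shows "tight T I pos ty"
proof -
  have I: "{i \<in> I. pos i \<noteq> v} = I" using b by blast
  obtain g L where L: "linkage (delete_vertex T v) I pos ty L"
    and c: "cut_cost (delete_vertex T v) I pos ty g = card L"
    using assms(4) by (auto simp: tight_def)
  have "{i \<in> I. (g(v := g u)) (pos i) \<noteq> ty i} = {i \<in> I. g (pos i) \<noteq> ty i}"
    using b by auto
  then have "cut_cost T I pos ty (g(v := g u)) = card L"
    using c unfolding cut_cost_def cut_edges_pendant[OF T] by simp
  with linkage_undelete[of T v I pos ty L] L show ?thesis unfolding tight_def I by blast
qed

lemma link_extend_token:
  assumes T: "simple_graph T" "neighbours T v = {u}"
    and k: "k \<in> I" "pos k = v"
    and m: "link (delete_vertex T v) (insert k {i \<in> I. pos i \<noteq> v}) (pos(k := u)) ty (i, j, p)"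
  shows "i \<noteq> k \<Longrightarrow> j \<noteq> k \<Longrightarrow> link T I pos ty (i, j, p)"
    "i = k \<Longrightarrow> link T I pos ty (i, j, v # p)"
    "j = k \<Longrightarrow> link T I pos ty (i, j, p @ [v])"
proof -
  have vu: "{v, u} \<in> edges T" using T(2) by (auto simp: neighbours_def)
  note v = edge_endpoints[OF T(1) vu]
  have p: "is_path T p" "v \<notin> set p" "p \<noteq> []"
    using m is_path_delete_vertex[of T v p] by (auto simp: link_def is_path_def)
  have ij: "i \<in> I" "j \<in> I" "ty i" "\<not> ty j" "hd p = (pos(k := u)) i" "last p = (pos(k := u)) j"
    using m k by (auto simp: link_def)
  show "i \<noteq> k \<Longrightarrow> j \<noteq> k \<Longrightarrow> link T I pos ty (i, j, p)"
    using p ij by (simp add: link_def)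
  show "link T I pos ty (i, j, v # p)" if "i = k"
  proof -
    have "j \<noteq> k" using ij that by blast
    then show ?thesis
      using p ij vu v k that by (auto simp: link_def is_path_def walk_edges_Cons)
  qed
  show "link T I pos ty (i, j, p @ [v])" if "j = k"
  proof -
    have "i \<noteq> k" using ij that by blast
    then show ?thesis
      using p ij vu v k that by (auto simp: link_def is_path_def walk_edges_snoc insert_commute)
  qed
qed

text \<open>At most one path of \<open>L\<close> ends at the moved token \<open>k\<close>. It is
  prolonged by the edge \<open>{v, u}\<close>, which no path of the smaller forest contains; the
  other paths stay as they are.\<close>

lemma linkage_extend_token:
  assumes T: "simple_graph T" "neighbours T v = {u}"
    and k: "k \<in> I" "pos k = v"
    and L: "linkage (delete_vertex T v) (insert k {i \<in> I. pos i \<noteq> v}) (pos(k := u)) ty L"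
  shows "\<exists>L'. linkage T I pos ty L' \<and> card L' = card L"
proof -
  let ?link = "link (delete_vertex T v) (insert k {i \<in> I. pos i \<noteq> v}) (pos(k := u)) ty"
  note ext = link_extend_token[where pos = pos and k = k, OF T k]
  have free: "linkage T I pos ty M" if "M \<subseteq> L" and M: "\<And>i j p. (i, j, p) \<in> M \<Longrightarrow> i \<noteq> k \<and> j \<noteq> k" for M
    using linkage_subset[OF L that(1)]
  proof (rule linkage_mono)
    fix m assume "m \<in> M" "?link m"
    then show "link T I pos ty m" using ext(1) M by (cases m) blast
  qed
  have mem: "?link m" if "m \<in> L" for m using L that by (simp add: linkage_def)
  have comp: "compatible m m'" if "m \<in> L" "m' \<in> L" "m \<noteq> m'" for m m'
    using L that by (auto simp: linkage_def pairwise_def)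
  have unused: "{v, u} \<notin> set (walk_edges p)" if "(i, j, p) \<in> L" for i j p
    using mem[OF that] is_path_delete_vertex[of T v p] walk_edges_subset[of "{v, u}" p]
    by (auto simp: link_def)
  have *: ?thesis if m: "(i, j, p) \<in> L" and k': "k \<in> {i, j}" and q: "link T I pos ty (i, j, q)"
    and e: "set (walk_edges q) \<subseteq> insert {v, u} (set (walk_edges p))" for i j p q
  proof -
    let ?M = "L - {(i, j, p)}"
    \<comment> \<open>A second link with \<open>k\<close> at the same end contradicts compatibility;
      with \<open>k\<close> at the other end it would give \<open>k\<close> both types.\<close>
    have "i' \<noteq> k \<and> j' \<noteq> k" if "(i', j', p') \<in> ?M" for i' j' p'
      using comp[OF m, of "(i', j', p')"] mem[OF m] mem[of "(i', j', p')"] that k'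
      by (auto simp: compatible_def link_def)
    then have M: "linkage T I pos ty ?M" by (intro free) auto
    have "L = insert (i, j, p) ?M" using m by blast
    with L have "linkage (delete_vertex T v) (insert k {i \<in> I. pos i \<noteq> v}) (pos(k := u)) ty
        (insert (i, j, p) ?M)" by simp
    from linkage_replace_path[OF this _ q M e] unused \<open>L = insert (i, j, p) ?M\<close>
    show ?thesis by (metis DiffD1 DiffD2 singletonI)
  qed
  consider (first) j p where "(k, j, p) \<in> L" | (second) i p where "(i, k, p) \<in> L"
    | (none) "\<And>i j p. (i, j, p) \<in> L \<Longrightarrow> i \<noteq> k \<and> j \<noteq> k" by blast
  then show ?thesis
  proof cases
    case first
    have "p \<noteq> []" "hd p = u" using mem[OF first] by (auto simp: link_def is_path_def)
    then show ?thesis using *[OF first _ ext(2)[OF mem[OF first]]] by (simp add: walk_edges_Cons)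
  next
    case second
    have "p \<noteq> []" "last p = u" using mem[OF second] by (auto simp: link_def is_path_def)
    then show ?thesis using *[OF second _ ext(3)[OF mem[OF second]]]
      by (simp add: walk_edges_snoc insert_commute)
  next
    case none
    then show ?thesis using free[of L] by blast
  qed
qed

text \<open>The token \<open>k\<close> moved to \<open>u\<close> is charged iff \<open>g u\<close>
  differs from \<open>ty k\<close>, which is exactly when setting \<open>g v\<close> to
  \<open>ty k\<close> cuts the edge \<open>{v, u}\<close>. No token on \<open>v\<close> is then
  charged, so the discarded ones cost nothing.\<close>

lemma tight_pendant:
  assumes T: "simple_graph T" "neighbours T v = {u}" and "finite I"
    and k: "k \<in> I" "pos k = v"
    and b: "\<And>i. i \<in> I \<Longrightarrow> pos i = v \<Longrightarrow> ty i = ty k"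
    and "tight (delete_vertex T v) (insert k {i \<in> I. pos i \<noteq> v}) (pos(k := u)) ty"
  shows "tight T I pos ty"
proof -
  let ?I = "{i \<in> I. pos i \<noteq> v}"
  obtain g L where L: "linkage (delete_vertex T v) (insert k ?I) (pos(k := u)) ty L"
    and c: "cut_cost (delete_vertex T v) (insert k ?I) (pos(k := u)) ty g = card L"
    using assms(7) by (auto simp: tight_def)
  obtain L' where L': "linkage T I pos ty L'" "card L' = card L"
    using linkage_extend_token[OF T k L] by blast
  have "{i \<in> insert k ?I. g ((pos(k := u)) i) \<noteq> ty i} =
      {i \<in> ?I. g (pos i) \<noteq> ty i} \<union> (if g u = ty k then {} else {k})"
    using k by auto
  moreover have "k \<notin> {i \<in> ?I. g (pos i) \<noteq> ty i}" "finite {i \<in> ?I. g (pos i) \<noteq> ty i}"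
    using k \<open>finite I\<close> by auto
  ultimately have "card {i \<in> insert k ?I. g ((pos(k := u)) i) \<noteq> ty i} =
      card {i \<in> ?I. g (pos i) \<noteq> ty i} + (if g u = ty k then 0 else 1)"
    by simp
  moreover have "{i \<in> I. (g(v := ty k)) (pos i) \<noteq> ty i} = {i \<in> ?I. g (pos i) \<noteq> ty i}"
    using b by auto
  ultimately have "cut_cost T I pos ty (g(v := ty k)) = card L"
    using c unfolding cut_cost_def cut_edges_pendant[OF T] by simp
  with L' show ?thesis unfolding tight_def by metis
qed

lemma forest_tight:
  fixes pos :: "'i \<Rightarrow> 'a"
  assumes "simple_graph T" "\<nexists>c. is_cycle T c" "finite I" "pos ` I \<subseteq> verts T"
  shows "tight T I pos ty"
  using assms
\<comment> \<open>Tokens are discarded and moved along the way, so \<open>I\<close> and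
  \<open>pos\<close> must vary; the types stay fixed.\<close>
proof (induction T arbitrary: I pos rule: forest_induct)
  case (empty T)
  then have "I = {}" "edges T = {}" by (auto simp: simple_graph_def card_2_iff)
  then have "linkage T I pos ty {}" "cut_cost T I pos ty (\<lambda>_. True) = card {}"
    by (auto simp: linkage_def cut_cost_def)
  then show ?case unfolding tight_def by blast
next
  case (isolated T v)
  show ?case
  proof (rule tight_cancel_tokens[OF _ isolated.hyps(2) \<open>finite I\<close>])
    fix J assume J: "J \<subseteq> I"
      "\<And>i j. i \<in> J \<Longrightarrow> j \<in> J \<Longrightarrow> pos i = v \<Longrightarrow> pos j = v \<Longrightarrow> ty i = ty j"
    then obtain b where b: "\<And>i. i \<in> J \<Longrightarrow> pos i = v \<Longrightarrow> ty i = b" by metis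
    have "tight (delete_vertex T v) {i \<in> J. pos i \<noteq> v} pos ty"
      using isolated.prems J by (intro isolated.IH) (auto simp: delete_vertex_def intro: finite_subset)
    then show "tight T J pos ty" using tight_isolated[of T v J pos ty b] isolated.hyps b by blast
  qed
next
  case (pendant T v u)
  have "{v, u} \<in> edges T" using pendant.hyps by (auto simp: neighbours_def)
  note u = edge_endpoints[OF pendant.hyps(1) this]
  show ?case
  proof (rule tight_cancel_tokens[OF _ pendant.hyps(2) \<open>finite I\<close>])
    fix J assume J: "J \<subseteq> I"
      and pure: "\<And>i j. i \<in> J \<Longrightarrow> j \<in> J \<Longrightarrow> pos i = v \<Longrightarrow> pos j = v \<Longrightarrow> ty i = ty j"
    have fin: "finite J" using J pendant.prems finite_subset by blast
    show "tight T J pos ty"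
    proof (cases "\<exists>k\<in>J. pos k = v")
      case False
      then have "tight (delete_vertex T v) J pos ty"
        using pendant.prems J fin by (intro pendant.IH) (auto simp: delete_vertex_def)
      with False show ?thesis by (intro tight_pendant_unused[OF pendant.hyps(1,3)]) blast+
    next
      case True
      then obtain k where k: "k \<in> J" "pos k = v" by blast
      have "tight (delete_vertex T v) (insert k {i \<in> J. pos i \<noteq> v}) (pos(k := u)) ty"
        using pendant.prems J fin u by (intro pendant.IH) (auto simp: delete_vertex_def)
      moreover have "ty i = ty k" if "i \<in> J" "pos i = v" for i using pure k that by blast
      ultimately show ?thesis
        by (intro tight_pendant[where pos = pos and k = k, OF pendant.hyps(1,3) fin k])
    qed
  qed
qed

section \<open>Balance and packings of odd paths\<close>

lemma cycle_sign_all_negative: "cycle_sign all_negative c = (- 1) ^ length (cycle_edges c)"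
proof -
  have "map all_negative xs = replicate (length xs) (- 1)" for xs :: "'a set list"
    by (induction xs) (auto simp: all_negative_def)
  then show ?thesis by (simp add: cycle_sign_def prod_list_replicate)
qed

text \<open>A cycle read as a closed walk returns to its initial class, so its length is even and
  its negative signs cancel.\<close>

lemma balanced_if_two_coloured:
  assumes "\<And>x y. {x, y} \<in> edges G \<Longrightarrow> f x \<noteq> (f y :: bool)"
  shows "balanced G all_negative"
  unfolding balanced_def
proof (intro allI impI)
  fix c assume c: "is_cycle G c"
  then have ne: "c \<noteq> []" and "set (walk_edges (c @ [hd c])) \<subseteq> edges G"
    by (auto simp: is_cycle_def cycle_edges_def)
  then have "f (hd (c @ [hd c])) = f (last (c @ [hd c])) \<longleftrightarrow> even (length (cycle_edges c))"
    unfolding cycle_edges_def using assms by (intro walk_alternates) auto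
  then show "cycle_sign all_negative c = 1" using ne by (simp add: cycle_sign_all_negative)
qed

section \<open>Packings are at most as large as balancing sets\<close>

lemma cycle_edges_Cons:
  "p \<noteq> [] \<Longrightarrow> cycle_edges (h # p) = {h, hd p} # walk_edges p @ [{last p, h}]"
  using walk_edges_snoc[of p h] walk_edges_Cons[of "p @ [h]" h] by (simp add: cycle_edges_def)

lemma is_cycle_through_apex:
  assumes "is_path (delete_vertex G h) p" "odd (length (walk_edges p))"
    "path_endpoints p \<subseteq> neighbours G h" "h \<in> verts G"
  shows "is_cycle G (h # p)" "cycle_sign all_negative (h # p) = - 1"
proof -
  have p: "is_path G p" "h \<notin> set p" using assms(1) is_path_delete_vertex by metis+
  then have ne: "p \<noteq> []" by (simp add: is_path_def)
  \<comment> \<open>An odd path has an edge, hence two vertices, and \<open>h\<close> completes the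
    three that a cycle requires.\<close>
  have "2 \<le> length p" using odd_pos[OF assms(2)] by (simp add: length_walk_edges)
  then show "is_cycle G (h # p)"
    using p ne assms(3,4)
    by (auto simp: is_cycle_def is_path_def cycle_edges_Cons path_endpoints_def neighbours_def
        insert_commute)
  show "cycle_sign all_negative (h # p) = - 1"
    using assms(2) ne by (simp add: cycle_sign_all_negative cycle_edges_Cons)
qed

text \<open>Each path of \<open>P\<close> closes through \<open>h\<close> to a negative cycle, which
  must lose an edge to \<open>F\<close>. Disjointness of edges and endpoints makes these cycles
  edge-disjoint, so choosing a lost edge is injective.\<close>

lemma card_packing_le_card_balancing:
  assumes "simple_graph G" "h \<in> verts G"
    and P: "odd_path_packing (delete_vertex G h) (neighbours G h) P"
    and F: "F \<subseteq> edges G" "balanced (delete_edges G F) all_negative"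
  shows "card P \<le> card F"
proof -
  have path: "is_path (delete_vertex G h) p" "odd (length (walk_edges p))"
    "path_endpoints p \<subseteq> neighbours G h" if "p \<in> P" for p
    using P that by (auto simp: odd_path_packing_def)
  have "\<exists>e\<in>F. e \<in> set (cycle_edges (h # p))" if "p \<in> P" for p
  proof (rule ccontr)
    note c = is_cycle_through_apex[OF path[OF that] assms(2)]
    assume "\<not> ?thesis"
    then have "is_cycle (delete_edges G F) (h # p)"
      using c(1) by (auto simp: is_cycle_def delete_edges_def)
    then have "cycle_sign all_negative (h # p) = 1" using F(2) by (simp add: balanced_def)
    then show False using c(2) by simp
  qed
  then obtain e where e: "\<And>p. p \<in> P \<Longrightarrow> e p \<in> F"
    "\<And>p. p \<in> P \<Longrightarrow> e p \<in> set (cycle_edges (h # p))" by metis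
  have "inj_on e P"
  proof (rule inj_onI, rule ccontr)
    fix p q assume pq: "p \<in> P" "q \<in> P" "e p = e q" "p \<noteq> q"
    \<comment> \<open>The chosen edge lies on the path and avoids \<open>h\<close>, or joins
      \<open>h\<close> to an endpoint. Edges of different kinds never coincide, and the packing
      conditions exclude equality within each kind.\<close>
    have shape: "e r \<in> set (walk_edges r) \<and> h \<notin> e r \<or> (\<exists>x\<in>path_endpoints r. e r = {h, x})"
      if "r \<in> P" for r
    proof -
      have "h \<notin> set r" "r \<noteq> []"
        using path(1)[OF that] is_path_delete_vertex[of G h r] by (auto simp: is_path_def)
      then show ?thesis using e(2)[OF that] walk_edges_subset[of "e r" r]
        by (auto simp: cycle_edges_Cons path_endpoints_def insert_commute)
    qed
    have "set (walk_edges p) \<inter> set (walk_edges q) = {}" "path_endpoints p \<inter> path_endpoints q = {}"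
      using P pq unfolding odd_path_packing_def by blast+
    then show False using shape[OF pq(1)] shape[OF pq(2)] pq(3) by (auto simp: doubleton_eq_iff)
  qed
  moreover have "finite F" using F(1) finite_edges[OF assms(1)] finite_subset by blast
  ultimately show ?thesis using e(1) card_inj_on_le[of e P F] by blast
qed

text \<open>Each element of \<open>S\<close> is a token sitting on itself, typed by its colour. A
  link therefore joins opposite colours, which makes its path odd.\<close>

lemma odd_path_packing_of_linkage:
  assumes L: "linkage T S (\<lambda>x. x) c L" and c: "\<And>x y. {x, y} \<in> edges T \<Longrightarrow> c x \<noteq> c y"
  shows "odd_path_packing T S ((\<lambda>(i, j, p). p) ` L)" "card ((\<lambda>(i, j, p). p) ` L) = card L"
proof -
  have link: "i = hd p" "j = last p" "is_path T p" "hd p \<in> S" "last p \<in> S" "c (hd p)" "\<not> c (last p)"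
    if "(i, j, p) \<in> L" for i j p
    using L that by (auto simp: linkage_def link_def)
  have disj: "hd p \<noteq> hd q" "last p \<noteq> last q" "set (walk_edges p) \<inter> set (walk_edges q) = {}"
    if "(i, j, p) \<in> L" "(i', j', q) \<in> L" "p \<noteq> q" for i j p i' j' q
  proof -
    have "compatible (i, j, p) (i', j', q)"
      using L that unfolding linkage_def pairwise_def by blast
    then show "hd p \<noteq> hd q" "last p \<noteq> last q" "set (walk_edges p) \<inter> set (walk_edges q) = {}"
      using link(1,2)[OF that(1)] link(1,2)[OF that(2)] by (auto simp: compatible_def)
  qed
  have odd: "odd (length (walk_edges p))" if "(i, j, p) \<in> L" for i j p
  proof -
    have "p \<noteq> []" "set (walk_edges p) \<subseteq> edges T" using link(3)[OF that] by (auto simp: is_path_def)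
    then have "c (hd p) = c (last p) \<longleftrightarrow> even (length (walk_edges p))"
      using c by (intro walk_alternates) auto
    then show ?thesis using link(6,7)[OF that] by blast
  qed
  have ends: "path_endpoints p \<inter> path_endpoints q = {}"
    if "(i, j, p) \<in> L" "(i', j', q) \<in> L" "p \<noteq> q" for i j p i' j' q
  proof -
    \<comment> \<open>First vertices are coloured \<open>True\<close> and last vertices
      \<open>False\<close>, so compatibility has only to separate first from first and last from
      last.\<close>
    have "hd p \<noteq> last q" "last p \<noteq> hd q" using link(6,7) that(1,2) by metis+
    then show ?thesis using disj(1,2)[OF that] by (simp add: path_endpoints_def)
  qed
  show "odd_path_packing T S ((\<lambda>(i, j, p). p) ` L)"
    unfolding odd_path_packing_def
  proof (intro conjI ballI impI)
    fix p assume "p \<in> (\<lambda>(i, j, p). p) ` L"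
    then obtain i j where p: "(i, j, p) \<in> L" by auto
    show "is_path T p" using link(3)[OF p] .
    show "odd (length (walk_edges p))" using odd[OF p] .
    show "path_endpoints p \<subseteq> S" using link(4,5)[OF p] by (simp add: path_endpoints_def)
    fix q assume "q \<in> (\<lambda>(i, j, p). p) ` L" and ne: "p \<noteq> q"
    then obtain i' j' where q: "(i', j', q) \<in> L" by auto
    show "set (walk_edges p) \<inter> set (walk_edges q) = {}" using disj(3)[OF p q ne] .
    show "path_endpoints p \<inter> path_endpoints q = {}" using ends[OF p q ne] .
  qed
  have "inj_on (\<lambda>(i, j, p). p) L" 
    by (rule inj_on_inverseI[where g = "\<lambda>p. (hd p, last p, p)"]) (auto dest: link(1,2))
  then show "card ((\<lambda>(i, j, p). p) ` L) = card L" by (rule card_image)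
qed

text \<open>A cut \<open>g\<close> of \<open>T\<close> becomes a bipartition of \<open>G\<close>: switch \<open>g\<close> by the colouring \<open>c\<close>
  and put \<open>h\<close> into the class \<open>True\<close>.\<close>

lemma balancing_set_of_cut:
  fixes c g :: "'a \<Rightarrow> bool"
  assumes G: "simple_graph G" and c: "\<And>x y. {x, y} \<in> edges (delete_vertex G h) \<Longrightarrow> c x \<noteq> c y"
  shows "\<exists>F\<subseteq>edges G. balanced (delete_edges G F) all_negative \<and>
    card F \<le> cut_cost (delete_vertex G h) (neighbours G h) (\<lambda>x. x) c g"
proof -
  let ?T = "delete_vertex G h"
  let ?W = "{i \<in> neighbours G h. g i \<noteq> c i}"
  let ?C = "{e \<in> edges ?T. \<exists>x\<in>e. \<exists>y\<in>e. g x \<noteq> g y}"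
  let ?F = "(\<lambda>i. {h, i}) ` ?W \<union> ?C"
  define f where "f = (\<lambda>x. x = h \<or> g x \<noteq> c x)"
  \<comment> \<open>Since \<open>f h\<close> is \<open>True\<close>, a surviving apex edge must lead
    to a vertex where \<open>f\<close> is \<open>False\<close>, that is, where \<open>g\<close> and
    \<open>c\<close> agree.\<close>
  have W: "g i = c i" if "i \<in> neighbours G h" "{h, i} \<notin> ?F" for i
  proof (rule ccontr)
    assume "g i \<noteq> c i"
    then have "{h, i} \<in> (\<lambda>i. {h, i}) ` ?W" using that(1) by (intro imageI) simp
    then have "{h, i} \<in> ?F" by (rule UnI1)
    with that(2) show False by contradiction
  qed
  have C: "g x = g y" if "{x, y} \<in> edges ?T" "{x, y} \<notin> ?F" for x y
  proof (rule ccontr)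
    assume "g x \<noteq> g y"
    then have "{x, y} \<in> ?C" using that(1) by simp
    then have "{x, y} \<in> ?F" by (rule UnI2)
    with that(2) show False by contradiction
  qed
  have "f x \<noteq> f y" if xy: "{x, y} \<in> edges (delete_edges G ?F)" for x y
  proof -
    have "{x, y} \<in> edges G \<and> {x, y} \<notin> ?F"
      using xy unfolding delete_edges_def ugraph.simps Diff_iff .
    note e = conjunct1[OF this] conjunct2[OF this]
    have "x \<noteq> y" using edge_endpoints(3)[OF G e(1)] .
    consider "x = h" | "y = h" | "x \<noteq> h" "y \<noteq> h" by blast
    then show ?thesis
    proof cases
      case 1
      then have "y \<in> neighbours G h" using e(1) by (simp add: neighbours_def)
      then have "g y = c y" using e(2)[unfolded 1] by (rule W)
      then show ?thesis using 1 \<open>x \<noteq> y\<close> by (simp add: f_def)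
    next
      case 2
      then have "x \<in> neighbours G h" using e(1) by (simp add: neighbours_def insert_commute)
      then have "g x = c x" using e(2)[unfolded 2 insert_commute[of x h]] by (rule W)
      then show ?thesis using 2 \<open>x \<noteq> y\<close> by (simp add: f_def)
    next
      case 3
      then have xy: "{x, y} \<in> edges ?T" using e(1) by (simp add: delete_vertex_def)
      \<comment> \<open>Along a surviving edge of the tree \<open>c\<close> changes and
        \<open>g\<close> does not, so their disagreement \<open>f\<close> changes.\<close>
      show ?thesis using c[OF xy] C[OF xy e(2)] 3 by (simp add: f_def)
    qed
  qed
  then have "balanced (delete_edges G ?F) all_negative" by (rule balanced_if_two_coloured)
  moreover have "?F \<subseteq> edges G" by (auto simp: neighbours_def delete_vertex_def)
  moreover have "card ?F \<le> cut_cost ?T (neighbours G h) (\<lambda>x. x) c g"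
  proof -
    have "neighbours G h \<subseteq> verts G"
      unfolding neighbours_def using edge_endpoints(2)[OF G] by blast
    moreover have "finite (verts G)" using G by (simp add: simple_graph_def)
    ultimately have "finite (neighbours G h)" by (rule finite_subset)
    then have "finite ?W" by simp
    then have "card ((\<lambda>i. {h, i}) ` ?W) \<le> card ?W" by (rule card_image_le)
    then show ?thesis unfolding cut_cost_def using card_Un_le[of "(\<lambda>i. {h, i}) ` ?W" ?C] by linarith
  qed
  ultimately show ?thesis by blast
qed

theorem corollary9:
  fixes G T :: "'a ugraph" and h :: 'a and n :: nat
  assumes "apex_tree n G h T"
  shows "frustration_index G all_negative =
           Max {card P | P. odd_path_packing T (neighbours G h) P}"
proof -
  have G: "simple_graph G" "h \<in> verts G" and T: "T = delete_vertex G h"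
    and forest: "simple_graph T" "\<nexists>c. is_cycle T c"
    using assms by (auto simp: apex_tree_def is_tree_def)
  have nb: "neighbours G h \<subseteq> verts T"
    using edge_endpoints(2,3)[OF G(1)] by (auto simp: neighbours_def T delete_vertex_def)
  have "finite (neighbours G h)"
    using nb forest(1) finite_subset by (auto simp: simple_graph_def)
  obtain c :: "'a \<Rightarrow> bool" where c: "\<And>x y. {x, y} \<in> edges T \<Longrightarrow> c x \<noteq> c y"
    using forest_two_colouring[OF forest] by blast
  obtain g L where L: "linkage T (neighbours G h) (\<lambda>x. x) c L"
    and cost: "cut_cost T (neighbours G h) (\<lambda>x. x) c g = card L"
    using forest_tight[OF forest \<open>finite (neighbours G h)\<close>, of "\<lambda>x. x" c] nb
    by (auto simp: tight_def)
  define P where "P = (\<lambda>(i, j, p). p) ` L"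
  have P: "odd_path_packing T (neighbours G h) P" "card P = card L"
    unfolding P_def using odd_path_packing_of_linkage[OF L c] by simp_all
  \<comment> \<open>The cut yields a balancing set no larger than the packing \<open>P\<close>
    obtained from the linkage; together with \<open>weak\<close> this makes both optimal.\<close>
  obtain F where F: "F \<subseteq> edges G" "balanced (delete_edges G F) all_negative" "card F \<le> card P"
    using balancing_set_of_cut[OF G(1), of h c g] c cost P(2) unfolding T by auto
  have weak: "card Q \<le> card E"
    if "odd_path_packing T (neighbours G h) Q" "E \<subseteq> edges G"
      "balanced (delete_edges G E) all_negative" for Q E
    using card_packing_le_card_balancing[OF G] that unfolding T by blast
  have eq: "card F = card P" using weak[OF P(1) F(1,2)] F(3) by simp
  have "frustration_index G all_negative = card F"
    unfolding frustration_index_def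
  proof (rule Min_eqI)
    show "finite {card F | F. F \<subseteq> edges G \<and> balanced (delete_edges G F) all_negative}"
      using finite_edges[OF G(1)] by simp
    show "card F \<in> {card F | F. F \<subseteq> edges G \<and> balanced (delete_edges G F) all_negative}"
      using F(1,2) by blast
  qed (use weak[OF P(1)] eq in auto)
  moreover have "Max {card P | P. odd_path_packing T (neighbours G h) P} = card P"
  proof (rule Max_eqI)
    \<comment> \<open>The balancing set \<open>F\<close> bounds the size of every packing, so only
      finitely many values occur.\<close>
    show "finite {card P | P. odd_path_packing T (neighbours G h) P}"
    proof (rule finite_subset)
      show "{card P | P. odd_path_packing T (neighbours G h) P} \<subseteq> {..card F}"
        using weak[OF _ F(1,2)] by blast
    qed simp
    show "card P \<in> {card P | P. odd_path_packing T (neighbours G h) P}"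
      using P(1) by blast
  qed (use weak[OF _ F(1,2)] eq in auto)
  ultimately show ?thesis using eq by simp
qed

end
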